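(* Let $1\le w<n$ be integers, let $F$ be a distribution satisfying Assumption 1 (see context), and let $S$ be the set of ironed intervals for $F$. Let $n$ players have costs drawn independently from $F$. If there is $r>1$ such that every interval $[a',b')\in S$ satisfies $a'\ge b'/r$, then the expected total payment of Mechanism 1 for buying $w$ data in expectation from these players is $2r$-approximate to the benchmark, i.e. $w\,F^{-1}\!\left(\frac wn\right)\le 2r\cdot \mathrm{OPT}$, where $\mathrm{OPT}$ is the expected total payment of the optimal Bayesian incentive compatible $w$-unit procurement mechanism $M$ described in the context.
   Context: Setting: $n$ players, all with the same data type, each willing to sell one unit (his data) at a private cost drawn independently from $F$ (costs are rescaled so that the privacy factor $\epsilon$ is $1$). Assumption 1: $F$ has a density $f$ with range $[a,b]\subseteq[0,\infty)$, $f$ is piecewise continuous, and $f(z)>0$ for all $z\in[a,b]$. The virtual cost function is $\phi(z)=z+\frac{F(z)}{f(z)}$. Ironing. For $q\in[0,1]$ let $h(q)=\phi(F^{-1}(q))$ and $H(q)=\int_0^qh(t)\,dt$. Let $G$ be the convex hull of $H$ on $[0,1]$: $G(q)=\min\{y:(q,y)\in\mathrm{conv}(\{(q',y'):q'\in[0,1],\,y'\ge H(q')\})\}$. Let $T=\{q: H(q)\ne G(q)\}$ and let $[y_i,z_i)$ be the smallest collection of intervals with $T=\bigcup_i(y_i,z_i)$ (the components of $T$). The set $S$ of ironed intervals is the set of intervals $[F^{-1}(y_i),F^{-1}(z_i))$. Let $g(q)=G'(q)$ where this exists, extended to $[0,1]$ by right-continuity (by the left limit at $q=1$). The ironed virtual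 cost function is $\bar\phi(z)=g(F(z))$. Mechanism $M$ (the benchmark): given reported costs $v=(v_1,\dots,v_n)$, buy from the $w$ players with smallest ironed virtual cost $\bar\phi(v_i)$, breaking ties uniformly at random. Let $\bar x_i(v_i,v_{-i})$ be the probability that $M$ buys from player $i$ (with $\bar x_i(t,v_{-i})=0$ for $t>b$). The payment $p_i(v_i,v_{-i})$ to player $i$ has expectation over $M$'s randomness $E[p_i(v_i,v_{-i})]=v_i\bar x_i(v_i,v_{-i})+\int_{v_i}^\infty\bar x_i(t,v_{-i})\,dt$. $\mathrm{OPT}=E_{v\sim F,\,M}\left[\sum_ip_i(v)\right]$. This is the benchmark, the expected payment of the optimal (payment-minimizing) Bayesian incentive compatible mechanism that always buys $w$ units. Mechanism 1 in this setting: each player is offered the price $F^{-1}(w/n)$; a player accepts exactly when his cost is at most this price, an accepting player receives this price in expectation, and others receive $0$. Its expected total payment is $wF^{-1}(w/n)$. *)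

theory Defs
  imports "HOL-Probability.Probability"
begin

text \<open>
  A cost distribution is given by its density \<open>f\<close> together with the endpoints \<open>a\<close> and \<open>b\<close>
  of its range.  Its distribution function \<open>F\<close> is the library's \<^const>\<open>cdf\<close> of
  \<open>cost_dist f\<close>.
\<close>

definition cost_dist :: "(real \<Rightarrow> real) \<Rightarrow> real measure" where
  "cost_dist f = density lborel (\<lambda>z. ennreal (f z))"

definition piecewise_continuous_on :: "real \<Rightarrow> real \<Rightarrow> (real \<Rightarrow> real) \<Rightarrow> bool" where
  "piecewise_continuous_on a b f \<longleftrightarrow>
     (\<exists>P. finite P \<and> (\<forall>z\<in>{a..b} - P. continuous (at z within {a..b}) f)) \<and>
     (\<forall>z\<in>{a..<b}. \<exists>l. (f \<longlongrightarrow> l) (at_right z)) \<and>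
     (\<forall>z\<in>{a<..b}. \<exists>l. (f \<longlongrightarrow> l) (at_left z))"

definition regular_density :: "(real \<Rightarrow> real) \<Rightarrow> real \<Rightarrow> real \<Rightarrow> bool" where
  "regular_density f a b \<longleftrightarrow>
     0 \<le> a \<and> a < b \<and>
     f \<in> borel_measurable borel \<and> prob_space (cost_dist f) \<and>
     piecewise_continuous_on a b f \<and>
     (\<forall>z\<in>{a..b}. 0 < f z) \<and> (\<forall>z. z \<notin> {a..b} \<longrightarrow> f z = 0)"

definition F_inv :: "(real \<Rightarrow> real) \<Rightarrow> real \<Rightarrow> real \<Rightarrow> real \<Rightarrow> real" where
  "F_inv f a b = the_inv_into {a..b} (cdf (cost_dist f))"

definition virtual_cost :: "(real \<Rightarrow> real) \<Rightarrow> real \<Rightarrow> real" where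
  "virtual_cost f z = z + cdf (cost_dist f) z / f z"


subsection \<open>Ironing\<close>

definition iron_h :: "(real \<Rightarrow> real) \<Rightarrow> real \<Rightarrow> real \<Rightarrow> real \<Rightarrow> real" where
  "iron_h f a b q = virtual_cost f (F_inv f a b q)"

definition iron_H :: "(real \<Rightarrow> real) \<Rightarrow> real \<Rightarrow> real \<Rightarrow> real \<Rightarrow> real" where
  "iron_H f a b q = integral {0..q} (iron_h f a b)"

text \<open>
  Only the values on \<open>[0,1]\<close> matter.  There the infimum is a minimum, because \<open>H\<close> is
  continuous on \<open>[0,1]\<close>.
\<close>

definition iron_G :: "(real \<Rightarrow> real) \<Rightarrow> real \<Rightarrow> real \<Rightarrow> real \<Rightarrow> real" where
  "iron_G f a b q =
     Inf {y. (q, y) \<in> convex hull {(q', y'). q' \<in> {0..1} \<and> y' \<ge> iron_H f a b q'}}"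

definition iron_T :: "(real \<Rightarrow> real) \<Rightarrow> real \<Rightarrow> real \<Rightarrow> real set" where
  "iron_T f a b = {q\<in>{0..1}. iron_H f a b q \<noteq> iron_G f a b q}"

definition ironed_intervals :: "(real \<Rightarrow> real) \<Rightarrow> real \<Rightarrow> real \<Rightarrow> real set set" where
  "ironed_intervals f a b =
     {{F_inv f a b y ..< F_inv f a b z} | y z. y < z \<and> {y<..<z} \<in> components (iron_T f a b)}"

text \<open>
  The derivative \<open>g\<close> of \<open>G\<close>.  The one-sided limits run only over the points of \<open>(0,1)\<close> at
  which \<open>G\<close> is differentiable.  The left limit at \<open>1\<close> need not be finite when \<open>f\<close> jumps at
  \<open>b\<close> from the left limit \<open>0\<close>.  In that case \<open>g 1\<close> is an unspecified real, which affects the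
  ironed virtual cost of the single cost \<open>b\<close> only, a null event.
\<close>

definition iron_g :: "(real \<Rightarrow> real) \<Rightarrow> real \<Rightarrow> real \<Rightarrow> real \<Rightarrow> real" where
  "iron_g f a b q =
     (let G = iron_G f a b; D = {t\<in>{0<..<1}. G differentiable (at t)}
      in if q \<in> D then deriv G q
         else if q < 1 then Lim (at q within (D \<inter> {q<..})) (deriv G)
         else Lim (at q within (D \<inter> {..<q})) (deriv G))"

definition ironed_virtual_cost :: "(real \<Rightarrow> real) \<Rightarrow> real \<Rightarrow> real \<Rightarrow> real \<Rightarrow> real" where
  "ironed_virtual_cost f a b z = iron_g f a b (cdf (cost_dist f) z)"


subsection \<open>The two mechanisms\<close>

text \<open>
  The players are \<open>0, \<dots>, n - 1\<close>.  The sets of \<open>w\<close> players with smallest ironed virtual cost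
  differ only in how ties at the marginal value are resolved, so breaking ties uniformly at
  random means drawing one of these sets uniformly.
\<close>

definition cost_profiles :: "(real \<Rightarrow> real) \<Rightarrow> nat \<Rightarrow> (nat \<Rightarrow> real) measure" where
  "cost_profiles f n = (\<Pi>\<^sub>M i\<in>{..<n}. cost_dist f)"

definition cheapest_sets ::
    "(real \<Rightarrow> real) \<Rightarrow> real \<Rightarrow> real \<Rightarrow> nat \<Rightarrow> nat \<Rightarrow> (nat \<Rightarrow> real) \<Rightarrow> nat set set" where
  "cheapest_sets f a b n w v =
     {W. W \<subseteq> {..<n} \<and> card W = w \<and>
         (\<forall>i\<in>W. \<forall>j\<in>{..<n} - W.
            ironed_virtual_cost f a b (v i) \<le> ironed_virtual_cost f a b (v j))}"

definition winners ::
    "(real \<Rightarrow> real) \<Rightarrow> real \<Rightarrow> real \<Rightarrow> nat \<Rightarrow> nat \<Rightarrow> (nat \<Rightarrow> real) \<Rightarrow> nat set pmf" where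
  "winners f a b n w v = pmf_of_set (cheapest_sets f a b n w v)"

definition allocation ::
    "(real \<Rightarrow> real) \<Rightarrow> real \<Rightarrow> real \<Rightarrow> nat \<Rightarrow> nat \<Rightarrow> nat \<Rightarrow> (nat \<Rightarrow> real) \<Rightarrow> real" where
  "allocation f a b n w i v =
     (if v i > b then 0 else measure_pmf.prob (winners f a b n w v) {W. i \<in> W})"

text \<open>The payment to player \<open>i\<close> in expectation over the randomness of the mechanism.\<close>

definition payment ::
    "(real \<Rightarrow> real) \<Rightarrow> real \<Rightarrow> real \<Rightarrow> nat \<Rightarrow> nat \<Rightarrow> nat \<Rightarrow> (nat \<Rightarrow> real) \<Rightarrow> real" where
  "payment f a b n w i v =
     v i * allocation f a b n w i v
     + (LBINT t:{v i..}. allocation f a b n w i (v(i := t)))"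

definition OPT :: "(real \<Rightarrow> real) \<Rightarrow> real \<Rightarrow> real \<Rightarrow> nat \<Rightarrow> nat \<Rightarrow> real" where
  "OPT f a b n w = (\<integral>v. (\<Sum>i<n. payment f a b n w i v) \<partial>cost_profiles f n)"

text \<open>Every player is offered the price \<open>F\<^sup>-\<^sup>1(w/n)\<close> and accepts iff it covers his cost.\<close>

definition posted_price_payment :: "(real \<Rightarrow> real) \<Rightarrow> real \<Rightarrow> real \<Rightarrow> nat \<Rightarrow> nat \<Rightarrow> real" where
  "posted_price_payment f a b n w =
     (let price = F_inv f a b (real w / real n)
      in \<integral>v. (\<Sum>i<n. if v i \<le> price then price else 0) \<partial>cost_profiles f n)"

end

theory Submission
  imports Defs
begin

text \<open>
  Since \<open>q F\<^sup>-\<^sup>1(q)\<close> is a primitive of \<open>h\<close>, we have \<open>H(q) = q F\<^sup>-\<^sup>1(q)\<close>, and the posted price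
  mechanism pays \<open>n H(q)\<close> at \<open>q = w/n\<close>.  Buying from a player exactly when his cost is below a
  threshold \<open>t\<close> costs \<open>t F(t) = H(F(t)) \<ge> G(F(t))\<close> in expectation; as the allocation of the
  benchmark is monotone in each cost, hence a mixture of thresholds, a supporting line of the
  convex \<open>G\<close> at \<open>q\<close> together with \<open>\<Sum>\<^sub>i x\<^sub>i = w\<close> gives \<open>OPT \<ge> n G(q)\<close>.  Finally \<open>H \<le> r G\<close>: on a
  component \<open>(y,z)\<close> of \<open>T\<close> the function \<open>G\<close> is the chord of \<open>H\<close>, and \<open>F\<^sup>-\<^sup>1(y) \<ge> F\<^sup>-\<^sup>1(z)/r\<close>.
\<close>

subsection \<open>Distribution function and quantiles\<close>

locale cost_distribution =
  fixes f :: "real \<Rightarrow> real" and a b :: real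
  assumes reg: "regular_density f a b"
begin

abbreviation "M \<equiv> cost_dist f"
abbreviation "F \<equiv> cdf M"
abbreviation "Q \<equiv> F_inv f a b"
abbreviation "H \<equiv> iron_H f a b"
abbreviation "G \<equiv> iron_G f a b"

lemma a_nonneg: "0 \<le> a" and ab: "a < b"
  and f_measurable [measurable]: "f \<in> borel_measurable borel"
  and f_pos: "a \<le> z \<Longrightarrow> z \<le> b \<Longrightarrow> 0 < f z"
  and f_outside: "z < a \<or> b < z \<Longrightarrow> f z = 0"
  using reg by (auto simp: regular_density_def)

lemma f_nonneg: "0 \<le> f z"
  using f_pos[of z] f_outside[of z] by fastforce

lemma sets_M [measurable_cong, simp]: "sets M = sets borel"
  by (simp add: cost_dist_def)

sublocale real_distribution M
  using reg by (auto simp: regular_density_def real_distribution_def real_distribution_axioms_def)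

lemma f_integrable: "integrable lborel f"
proof -
  have "(\<integral>\<^sup>+ z. ennreal (f z) \<partial>lborel) = 1"
    using emeasure_space_1 by (simp add: cost_dist_def emeasure_density)
  then show ?thesis
    using f_nonneg by (intro integrableI_nonneg) auto
qed

lemma f_set_integrable: "A \<in> sets borel \<Longrightarrow> set_integrable lborel A f"
  unfolding set_integrable_def using f_integrable by (intro integrable_mult_indicator) auto

lemma measure_M:
  assumes "A \<in> sets borel"
  shows "measure M A = (LBINT z:A. f z)"
proof -
  have "emeasure M A = (\<integral>\<^sup>+ z. ennreal (indicator A z *\<^sub>R f z) \<partial>lborel)"
    unfolding cost_dist_def using assms
    by (subst emeasure_density) (auto intro!: nn_integral_cong simp: indicator_def)
  also have "\<dots> = ennreal (LBINT z:A. f z)"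
    unfolding set_lebesgue_integral_def using f_set_integrable[OF assms] f_nonneg
    by (intro nn_integral_eq_integral) (auto simp: set_integrable_def)
  finally show ?thesis
    using f_nonneg
    by (simp add: measure_def set_lebesgue_integral_def Bochner_Integration.integral_nonneg)
qed

lemma AE_M_iff: "(AE z in M. P z) \<longleftrightarrow> (AE z in lborel. 0 < f z \<longrightarrow> P z)"
  unfolding cost_dist_def by (subst AE_density) auto

lemma AE_range: "AE z in M. a < z \<and> z < b"
  unfolding AE_M_iff
  using AE_lborel_singleton[of a] AE_lborel_singleton[of b]
proof eventually_elim
  case (elim z) then show ?case using f_outside[of z] by force
qed

lemma integral_M: "g \<in> borel_measurable borel \<Longrightarrow> (\<integral>z. g z \<partial>M) = (\<integral>z. f z * g z \<partial>lborel)"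
  unfolding cost_dist_def using f_nonneg by (subst integral_density) auto

lemma F_eq_integral:
  assumes "a \<le> z"
  shows "F z = integral {a..z} f"
proof -
  have "F z = (LBINT t:{..z}. f t)"
    by (simp add: cdf_def measure_M)
  also have "\<dots> = (LBINT t:{a..z}. f t)"
    unfolding set_lebesgue_integral_def
    by (intro Bochner_Integration.integral_cong) (use f_outside in \<open>auto simp: indicator_def\<close>)
  also have "\<dots> = integral {a..z} f"
    by (intro set_borel_integral_eq_integral f_set_integrable) auto
  finally show ?thesis .
qed

lemma isCont_F: "isCont F z"
proof -
  have "measure M {z} = 0"
    unfolding measure_M[OF borel_closed[OF closed_singleton]] set_lebesgue_integral_def
    by (rule integral_eq_zero_AE[OF AE_mp[OF AE_lborel_singleton[of z]]]) (simp add: indicator_def)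
  then show ?thesis by (simp add: isCont_cdf)
qed

lemma F_a: "F a = 0"
  by (simp add: F_eq_integral)

lemma F_b: "F b = 1"
proof -
  have "prob {..b} = 1"
    using AE_range by (intro prob_eq_1[THEN iffD2]) auto
  then show ?thesis by (simp add: cdf_def)
qed

text \<open>A vanishing integral over \<open>{x<..y}\<close> would force \<open>f = 0\<close> almost
  everywhere there, although \<open>f\<close> is positive and the interval has positive length.
  Strictness is what lets \<open>Q\<close> invert \<open>F\<close> on the whole range.\<close>

lemma F_strict_mono:
  assumes "a \<le> x" "x < y" "y \<le> b"
  shows "F x < F y"
proof -
  have "F y - F x = (LBINT z:{x<..y}. f z)"
    using assms by (simp add: cdf_diff_eq measure_M)
  moreover have "0 \<le> (LBINT z:{x<..y}. f z)"
    using f_nonneg by (simp add: set_lebesgue_integral_def Bochner_Integration.integral_nonneg)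
  moreover have "(LBINT z:{x<..y}. f z) \<noteq> 0"
  proof
    assume "(LBINT z:{x<..y}. f z) = 0"
    then have "AE z in lborel. indicator {x<..y} z *\<^sub>R f z = 0"
      using f_nonneg f_set_integrable[of "{x<..y}"] unfolding set_lebesgue_integral_def set_integrable_def
      by (subst (asm) integral_nonneg_eq_0_iff_AE) auto
    then have "AE z in lborel. z \<notin> {x<..y}"
    proof eventually_elim
      case (elim z) then show ?case using f_pos[of z] assms by (auto simp: indicator_def)
    qed
    then have "emeasure lborel {x<..y} = 0"
      by (subst (asm) AE_iff_measurable[of "{x<..y}"]) auto
    then show False using assms by auto
  qed
  ultimately show ?thesis by linarith
qed

lemma inj_on_F: "inj_on F {a..b}"
proof (rule inj_onI)
  fix x y assume "x \<in> {a..b}" "y \<in> {a..b}" "F x = F y"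
  then show "x = y"
    using F_strict_mono[of x y] F_strict_mono[of y x] by (cases x y rule: linorder_cases) auto
qed

lemma F_image: "F ` {a..b} = {0..1}"
proof
  show "F ` {a..b} \<subseteq> {0..1}"
    using cdf_nonneg cdf_bounded_prob by auto
  show "{0..1} \<subseteq> F ` {a..b}"
  proof
    fix q :: real assume "q \<in> {0..1}"
    then have "\<exists>x\<ge>a. x \<le> b \<and> F x = q"
      using ab by (intro IVT) (auto simp: F_a F_b isCont_F)
    then show "q \<in> F ` {a..b}" by auto
  qed
qed

lemma Q_F: "a \<le> z \<Longrightarrow> z \<le> b \<Longrightarrow> Q (F z) = z"
  unfolding F_inv_def using inj_on_F by (auto intro: the_inv_into_f_f)

lemma F_Q: "0 \<le> q \<Longrightarrow> q \<le> 1 \<Longrightarrow> F (Q q) = q"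
  unfolding F_inv_def using inj_on_F by (auto intro: f_the_inv_into_f simp: F_image)

lemma Q_range: "0 \<le> q \<Longrightarrow> q \<le> 1 \<Longrightarrow> a \<le> Q q \<and> Q q \<le> b"
  using F_image Q_F by (metis (no_types, opaque_lifting) atLeastAtMost_iff imageE)

lemma Q_strict_mono: 
  assumes "0 \<le> p" "p < q" "q \<le> 1"
  shows "Q p < Q q"
proof (rule ccontr)
  assume "\<not> Q p < Q q"
  then have "F (Q q) \<le> F (Q p)" by (intro cdf_nondecreasing) simp
  then show False using assms by (simp add: F_Q)
qed

lemma Q_mono: "0 \<le> p \<Longrightarrow> p \<le> q \<Longrightarrow> q \<le> 1 \<Longrightarrow> Q p \<le> Q q"
  using Q_strict_mono[of p q] by (cases "p = q") auto

lemma continuous_on_Q: "continuous_on {0..1} Q"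
proof -
  have "continuous_on (F ` {a..b}) Q"
    by (rule continuous_on_inv)
      (auto simp: Q_F intro!: continuous_at_imp_continuous_on isCont_F)
  then show ?thesis by (simp add: F_image)
qed

text \<open>The derivative exists wherever \<open>f\<close> is continuous. The exceptional set is
  kept finite because the fundamental theorem of calculus, as applied below, tolerates a finite
  set.\<close>

lemma F_deriv:
  obtains P where "finite P"
    "\<And>z. z \<in> {a<..<b} - P \<Longrightarrow> (F has_real_derivative f z) (at z)"
proof -
  obtain P where P: "finite P" "\<forall>z\<in>{a..b} - P. continuous (at z within {a..b}) f"
    using reg by (auto simp: regular_density_def piecewise_continuous_on_def)
  have "(F has_real_derivative f z) (at z)" if z: "z \<in> {a<..<b} - P" for z
  proof -
    have "f integrable_on {a..b}"
      by (intro set_borel_integral_eq_integral f_set_integrable) auto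
    then have "((\<lambda>u. integral {a..u} f) has_vector_derivative f z) (at z within ({a..b} - {}))"
      using P z by (intro integral_has_vector_derivative_continuous_at) auto
    then have "((\<lambda>u. integral {a..u} f) has_real_derivative f z) (at z within {a<..<b})"
      unfolding has_real_derivative_iff_has_vector_derivative
      by (rule has_vector_derivative_within_subset) auto
    then have "((\<lambda>u. integral {a..u} f) has_real_derivative f z) (at z)"
      using z by (subst (asm) at_within_open) auto
    moreover have "\<forall>\<^sub>F u in nhds z. integral {a..u} f = F u"
      using z by (intro eventually_nhds_in_open[of "{a<..}" z, THEN eventually_mono])
        (auto simp: F_eq_integral)
    ultimately show ?thesis
      using DERIV_cong_ev by fast
  qed
  with P(1) that show ?thesis by blast
qed

text \<open>Where \<open>f\<close> is continuous at \<open>Q t\<close>, the derivative of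
  \<open>t * Q t\<close> is \<open>Q t + t / f (Q t)\<close>, which is \<open>h\<close> at
  \<open>t\<close>. As \<open>f\<close> may have a one-sided limit \<open>0\<close>,
  \<open>h\<close> can be unbounded; the fundamental theorem for the gauge integral delivers
  integrability together with the value.\<close>

lemma H_eq:
  assumes q: "0 \<le> q" "q \<le> 1"
  shows "H q = q * Q q"
proof -
  obtain P where P: "finite P" "\<And>z. z \<in> {a<..<b} - P \<Longrightarrow> (F has_real_derivative f z) (at z)"
    using F_deriv by blast
  have "(iron_h f a b has_integral q * Q q - 0 * Q 0) {0..q}"
  proof (rule fundamental_theorem_of_calculus_interior_strong[OF finite_imageI[OF P(1), of F] q(1)])
    show "continuous_on {0..q} (\<lambda>t. t * Q t)"
      using q by (intro continuous_intros continuous_on_subset[OF continuous_on_Q]) auto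
    fix t assume t: "t \<in> {0<..<q} - F ` P"
    then have "Q 0 < Q t" "Q t < Q 1" using q by (auto intro!: Q_strict_mono)
    moreover have "Q 0 = a" "Q 1 = b" using Q_F[of a] Q_F[of b] ab by (auto simp: F_a F_b)
    moreover have "Q t \<notin> P" using t q F_Q[of t] by force
    ultimately have "(F has_real_derivative f (Q t)) (at (Q t))" "f (Q t) > 0"
      using P(2) f_pos by auto
    moreover have "isCont Q t"
      using continuous_on_interior[OF continuous_on_Q] t q by auto
    ultimately have "(Q has_real_derivative inverse (f (Q t))) (at t)"
      using t q by (intro DERIV_inverse_function[where f=F and a=0 and b=1]) (auto simp: F_Q)
    then have "((\<lambda>t. t * Q t) has_real_derivative iron_h f a b t) (at t)"
      using t q by (auto intro!: derivative_eq_intros simp: iron_h_def virtual_cost_def F_Q divide_inverse)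
    then show "((\<lambda>t. t * Q t) has_vector_derivative iron_h f a b t) (at t)"
      by (simp add: has_real_derivative_iff_has_vector_derivative)
  qed
  then show ?thesis by (simp add: iron_H_def integral_unique)
qed

end

subsection \<open>Convex functions and the ironed curve\<close>

text \<open>If \<open>K\<close> is positive up to some \<open>p > q\<close> with minimum
  \<open>d\<close> on \<open>{0..p}\<close>, the line from \<open>(0, d)\<close> to
  \<open>(p, 0)\<close> is at most \<open>d\<close> before \<open>p\<close> and at most
  \<open>0\<close> after it. In \<open>ironed_component\<close> this rules out that \<open>H\<close>
  stays strictly above a supporting line of \<open>G\<close> on all of
  \<open>{0..q}\<close>.\<close>

lemma affine_minorant_positive_left:
  fixes K :: "real \<Rightarrow> real"
  assumes K: "continuous_on {0..1} K" "\<And>t. 0 \<le> t \<Longrightarrow> t \<le> 1 \<Longrightarrow> 0 \<le> K t"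
    and q: "0 < q" "q < 1" and pos: "\<And>t. 0 \<le> t \<Longrightarrow> t \<le> q \<Longrightarrow> 0 < K t"
  shows "\<exists>\<alpha> \<beta>. (\<forall>t\<in>{0..1}. \<alpha> + \<beta> * t \<le> K t) \<and> 0 < \<alpha> + \<beta> * q"
proof -
  have "isCont K q"
    using continuous_on_interior[OF K(1)] q by auto
  then have "\<forall>\<^sub>F t in nhds q. 0 < K t"
    using pos[of q] q by (auto simp: isCont_def tendsto_at_iff_tendsto_nhds dest: order_tendstoD(1))
  then obtain e where e: "0 < e" "\<And>t. dist t q < e \<Longrightarrow> 0 < K t"
    by (auto simp: eventually_nhds_metric)
  \<comment> \<open>Half the radius keeps \<open>p\<close> inside the ball where \<open>K\<close> is
    positive, and the cap keeps it in the domain.\<close>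
  define p where "p = min 1 (q + e / 2)"
  have p: "q < p" "p \<le> 1" using e q by (auto simp: p_def)
  have pos': "0 < K t" if "0 \<le> t" "t \<le> p" for t
    using that pos[of t] e(2)[of t] e(1) by (cases "t \<le> q") (auto simp: p_def dist_real_def)
  obtain m where m: "m \<in> {0..p}" "\<And>t. t \<in> {0..p} \<Longrightarrow> K m \<le> K t"
    using continuous_attains_inf[of "{0..p}" K] continuous_on_subset[OF K(1), of "{0..p}"] p q by auto
  define d where "d = K m"
  have d: "0 < d" using m pos' by (auto simp: d_def)
  show ?thesis
  proof (rule exI[of _ d], rule exI[of _ "- d / p"], intro conjI ballI)
    fix t :: real assume "t \<in> {0..1}"
    then have t: "0 \<le> t" "t \<le> 1" by auto
    have "d + - d / p * t = d * (1 - t / p)" by (simp add: algebra_simps)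
    also have "\<dots> \<le> K t"
    proof (cases "t \<le> p")
      case True
      have "d * (1 - t / p) \<le> d * 1" using d t p q by (intro mult_left_mono) auto
      also have "\<dots> \<le> K t" using m(2)[of t] True t by (simp add: d_def)
      finally show ?thesis .
    next
      case False
      then have "d * (1 - t / p) \<le> 0" using d p q by (simp add: mult_le_0_iff)
      with K(2)[OF t] show ?thesis by simp
    qed
    finally show "d + - d / p * t \<le> K t" .
  next
    have "0 < d * (1 - q / p)" using d p q by simp
    then show "0 < d + - d / p * q" by (simp add: algebra_simps)
  qed
qed

text \<open>Mirror image of the previous lemma under the reflection sending \<open>t\<close> to
  \<open>1 - t\<close>.\<close>

lemma affine_minorant_positive_right:
  fixes K :: "real \<Rightarrow> real"
  assumes K: "continuous_on {0..1} K" "\<And>t. 0 \<le> t \<Longrightarrow> t \<le> 1 \<Longrightarrow> 0 \<le> K t"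
    and q: "0 < q" "q < 1" and pos: "\<And>t. q \<le> t \<Longrightarrow> t \<le> 1 \<Longrightarrow> 0 < K t"
  shows "\<exists>\<alpha> \<beta>. (\<forall>t\<in>{0..1}. \<alpha> + \<beta> * t \<le> K t) \<and> 0 < \<alpha> + \<beta> * q"
proof -
  have "continuous_on {0..1} (\<lambda>t. K (1 - t))"
    by (intro continuous_on_compose2[OF K(1)] continuous_intros) auto
  then have "\<exists>\<alpha> \<beta>. (\<forall>t\<in>{0..1}. \<alpha> + \<beta> * t \<le> K (1 - t)) \<and> 0 < \<alpha> + \<beta> * (1 - q)"
    by (rule affine_minorant_positive_left) (use K(2) q pos in auto)
  then obtain \<alpha> \<beta> where A: "\<And>t. t \<in> {0..1} \<Longrightarrow> \<alpha> + \<beta> * t \<le> K (1 - t)" "0 < \<alpha> + \<beta> * (1 - q)"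
    by blast
  show ?thesis
  proof (intro exI conjI ballI)
    show "\<alpha> + \<beta> + - \<beta> * t \<le> K t" if "t \<in> {0..1}" for t
      using A(1)[of "1 - t"] that by (simp add: algebra_simps)
  qed (use A(2) in \<open>simp add: algebra_simps\<close>)
qed

section \<open>Subgradients and differentiability of convex functions on the line\<close>

lemma convex_on_subgradient:
  fixes g :: "real \<Rightarrow> real"
  assumes "convex_on I g" "x \<in> interior I"
  obtains c where "\<And>y. y \<in> I \<Longrightarrow> g x + c * (y - x) \<le> g y"
  using convex_le_Inf_differential[OF assms] by blast

text \<open>Any choice \<open>c\<close> of subgradients is monotone, hence has countably many
  discontinuities, and continuity of \<open>c\<close> at a point forces differentiability
  there.\<close>

lemma convex_on_countable_nondifferentiable:
  fixes g :: "real \<Rightarrow> real"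
  assumes "open I" and g: "convex_on I g"
  shows "countable {x \<in> I. \<not> g differentiable (at x)}"
proof -
  have "\<exists>c. \<forall>y\<in>I. g x + c * (y - x) \<le> g y" if "x \<in> I" for x
    using convex_on_subgradient[OF g, of x] that interior_open[OF \<open>open I\<close>] by metis
  then obtain c where c: "\<And>x y. x \<in> I \<Longrightarrow> y \<in> I \<Longrightarrow> g x + c x * (y - x) \<le> g y"
    by metis
  have "mono_on I c"
  proof (rule mono_onI)
    fix x y assume "x \<in> I" "y \<in> I" "x \<le> y"
    then have "c x * (y - x) \<le> c y * (y - x)"
      using c[of x y] c[of y x] by (simp add: algebra_simps)
    with \<open>x \<le> y\<close> show "c x \<le> c y" by (cases "x = y") (auto simp: mult_le_cancel_right)
  qed
  then have "countable {x \<in> I. \<not> isCont c x}"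
    using mono_on_ctble_discont_open \<open>open I\<close> by blast
  moreover have "{x \<in> I. \<not> g differentiable (at x)} \<subseteq> {x \<in> I. \<not> isCont c x}"
  proof -
    have "g differentiable (at x)" if x: "x \<in> I" and cont: "isCont c x" for x
    proof -
      have ev: "\<forall>\<^sub>F y in at x. y \<in> I - {x}"
        using eventually_nhds_in_open[OF \<open>open I\<close> x] by (auto simp: eventually_at_filter elim: eventually_mono)
      \<comment> \<open>The supporting lines at \<open>x\<close> and at \<open>y\<close> enclose the
        difference quotient between \<open>c x\<close> and \<open>c y\<close>.\<close>
      have *: "\<bar>(g y - g x) / (y - x) - c x\<bar> \<le> \<bar>c y - c x\<bar>" if "y \<in> I - {x}" for y
      proof -
        have "g x + c x * (y - x) \<le> g y" "g y + c y * (x - y) \<le> g x" using c x that by auto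
        then have "\<bar>g y - g x - c x * (y - x)\<bar> \<le> \<bar>(c y - c x) * (y - x)\<bar>"
          by (simp add: algebra_simps abs_if)
        then have "\<bar>g y - g x - c x * (y - x)\<bar> / \<bar>y - x\<bar> \<le> \<bar>c y - c x\<bar>"
          using that by (simp add: abs_mult divide_le_eq)
        moreover have "(g y - g x) / (y - x) - c x = (g y - g x - c x * (y - x)) / (y - x)"
          using that by (simp add: field_simps)
        ultimately show ?thesis by (simp add: abs_divide)
      qed
      have "((\<lambda>y. c y - c x) \<longlongrightarrow> 0) (at x)"
        using cont by (simp add: isCont_def LIM_zero_iff)
      then have "((\<lambda>y. (g y - g x) / (y - x) - c x) \<longlongrightarrow> 0) (at x)"
        by (rule Lim_null_comparison[OF _ tendsto_rabs_zero, rotated])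
          (use ev * in \<open>auto elim!: eventually_mono\<close>)
      then have "(g has_real_derivative c x) (at x)"
        by (simp add: has_field_derivative_iff LIM_zero_iff)
      then show ?thesis by (auto simp: real_differentiable_def)
    qed
    then show ?thesis by blast
  qed
  ultimately show ?thesis using countable_subset by blast
qed

section \<open>The convex hull of \<open>H\<close> and its affine pieces\<close>

context cost_distribution
begin

lemma H_nonneg: "0 \<le> q \<Longrightarrow> q \<le> 1 \<Longrightarrow> 0 \<le> H q"
  using Q_range[of q] a_nonneg by (auto simp: H_eq)

lemma continuous_on_H: "continuous_on {0..1} H"
proof -
  have "continuous_on {0..1} (\<lambda>q. q * Q q)"
    by (intro continuous_intros continuous_on_Q)
  then show ?thesis by (rule continuous_on_eq) (auto simp: H_eq)
qed

definition hull_H :: "(real \<times> real) set" where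
  "hull_H = convex hull {(q', y'). q' \<in> {0..1} \<and> y' \<ge> H q'}"

lemma G_eq_Inf: "G q = Inf {y. (q, y) \<in> hull_H}"
  by (simp add: iron_G_def hull_H_def)

text \<open>The region above a line is a half-space with normal \<open>(- \<beta>, 1)\<close>; being
  convex, it contains the hull as soon as it contains the generating points.\<close>

lemma hull_H_above_affine:
  assumes "\<And>t. 0 \<le> t \<Longrightarrow> t \<le> 1 \<Longrightarrow> \<alpha> + \<beta> * t \<le> H t" and "(q, y) \<in> hull_H"
  shows "\<alpha> + \<beta> * q \<le> y"
proof -
  have "convex {p. inner (- \<beta>, 1) p \<ge> \<alpha>}" by (rule convex_halfspace_ge)
  then have "hull_H \<subseteq> {p. inner (- \<beta>, 1) p \<ge> \<alpha>}"
    unfolding hull_H_def using assms(1) by (intro hull_minimal) (force simp: algebra_simps)+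
  with assms(2) show ?thesis by (auto simp: algebra_simps)
qed

lemma hull_H_graph: "0 \<le> q \<Longrightarrow> q \<le> 1 \<Longrightarrow> (q, H q) \<in> hull_H"
  unfolding hull_H_def by (rule hull_inc) simp

lemma bdd_below_hull_H: "bdd_below {y. (q, y) \<in> hull_H}"
  using hull_H_above_affine[of 0 0 q] H_nonneg by (auto intro!: bdd_belowI[of _ 0])

lemma G_le: "(q, y) \<in> hull_H \<Longrightarrow> G q \<le> y"
  unfolding G_eq_Inf using bdd_below_hull_H by (intro cInf_lower) auto

lemma G_le_H: "0 \<le> q \<Longrightarrow> q \<le> 1 \<Longrightarrow> G q \<le> H q"
  using G_le hull_H_graph by blast

text \<open>Lower bounds on \<open>G\<close> come from lines below \<open>H\<close>: nonnegativity
  from the zero line, and in \<open>ironed_component\<close> a contradiction from a line that would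
  exceed \<open>G q\<close>.\<close>

lemma G_ge_affine:
  assumes "\<And>t. 0 \<le> t \<Longrightarrow> t \<le> 1 \<Longrightarrow> \<alpha> + \<beta> * t \<le> H t" and "0 \<le> q" "q \<le> 1"
  shows "\<alpha> + \<beta> * q \<le> G q"
  unfolding G_eq_Inf using hull_H_graph[OF assms(2,3)] hull_H_above_affine[OF assms(1)]
  by (intro cInf_greatest) auto

lemma G_nonneg: "0 \<le> q \<Longrightarrow> q \<le> 1 \<Longrightarrow> 0 \<le> G q"
  using G_ge_affine[of 0 0 q] H_nonneg by simp

text \<open>Points of the hull within \<open>e\<close> of the infimum stand in for minimizers, so
  the argument does not depend on the infimum being attained.\<close>

lemma convex_on_G: "convex_on {0..1} G"
proof (rule convex_onI)
  fix t x y :: real assume t: "0 < t" "t < 1" and x: "x \<in> {0..1}" and y: "y \<in> {0..1}"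
  show "G ((1 - t) *\<^sub>R x + t *\<^sub>R y) \<le> (1 - t) * G x + t * G y"
  proof (rule field_le_epsilon)
    fix e :: real assume "0 < e"
    obtain u where u: "(x, u) \<in> hull_H" "u < G x + e"
      using cInf_lessD[of "{u. (x, u) \<in> hull_H}" "G x + e"] hull_H_graph[of x] x \<open>0 < e\<close>
      by (auto simp flip: G_eq_Inf)
    obtain v where v: "(y, v) \<in> hull_H" "v < G y + e"
      using cInf_lessD[of "{u. (y, u) \<in> hull_H}" "G y + e"] hull_H_graph[of y] y \<open>0 < e\<close>
      by (auto simp flip: G_eq_Inf)
    have "convex hull_H" by (simp add: hull_H_def convex_convex_hull)
    then have "(1 - t) *\<^sub>R (x, u) + t *\<^sub>R (y, v) \<in> hull_H"
      using u v t by (intro convexD) auto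
    then have "G ((1 - t) *\<^sub>R x + t *\<^sub>R y) \<le> (1 - t) * u + t * v"
      by (intro G_le) simp
    also have "\<dots> \<le> (1 - t) * (G x + e) + t * (G y + e)"
      using u v t by (intro add_mono mult_left_mono) auto
    finally show "G ((1 - t) *\<^sub>R x + t *\<^sub>R y) \<le> (1 - t) * G x + t * G y + e"
      by (simp add: algebra_simps)
  qed
qed simp

lemma G_supporting_line:
  assumes "0 < q" "q < 1"
  obtains c where "\<And>t. 0 \<le> t \<Longrightarrow> t \<le> 1 \<Longrightarrow> G q + c * (t - q) \<le> G t"
proof -
  have "q \<in> interior {0..1}" using assms by simp
  from convex_on_subgradient[OF convex_on_G this] show thesis
    using that by (metis atLeastAtMost_iff)
qed

text \<open>Subtract from \<open>H\<close> a supporting line of \<open>G\<close> at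
  \<open>q\<close>. The difference \<open>K\<close> is nonnegative and must vanish on both sides of
  \<open>q\<close>, since otherwise the line could be tilted upwards at \<open>q\<close> while
  staying below \<open>H\<close>. The zeros nearest to \<open>q\<close> bound the component, and
  \<open>G q\<close> lies on the chord of \<open>H\<close> between them.\<close>

lemma ironed_component:
  assumes q: "0 < q" "q < 1" and T: "q \<in> iron_T f a b"
  obtains y z where "0 \<le> y" "y < q" "q < z" "z \<le> 1"
    "{y<..<z} \<in> components (iron_T f a b)"
    "(z - y) * G q = (z - q) * H y + (q - y) * H z"
proof -
  obtain c where c: "\<And>t. 0 \<le> t \<Longrightarrow> t \<le> 1 \<Longrightarrow> G q + c * (t - q) \<le> G t"
    using G_supporting_line[OF q] by blast
  define K where "K t = H t - (G q + c * (t - q))" for t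
  have K_nonneg: "0 \<le> K t" if "0 \<le> t" "t \<le> 1" for t
    using c[OF that] G_le_H[OF that] by (simp add: K_def)
  have K_cont: "continuous_on {0..1} K"
    unfolding K_def by (intro continuous_intros continuous_on_H)
  have K_q: "0 < K q"
    using T G_le_H[of q] by (auto simp: K_def iron_T_def)
  define Z where "Z = {t\<in>{0..1}. K t = 0}"
  have "closed Z"
    unfolding Z_def using continuous_closed_preimage_constant[OF K_cont] by simp
  \<comment> \<open>Adding such an affine function to the supporting line would keep it below
    \<open>H\<close> and lift it above \<open>G q\<close>.\<close>
  have no_minorant: "\<not> (\<exists>\<alpha> \<beta>. (\<forall>t\<in>{0..1}. \<alpha> + \<beta> * t \<le> K t) \<and> 0 < \<alpha> + \<beta> * q)"
  proof safe
    fix \<alpha> \<beta> assume A: "\<forall>t\<in>{0..1}. \<alpha> + \<beta> * t \<le> K t" "0 < \<alpha> + \<beta> * q"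
    have "(G q - c * q + \<alpha>) + (c + \<beta>) * q \<le> G q"
    proof (rule G_ge_affine)
      show "G q - c * q + \<alpha> + (c + \<beta>) * t \<le> H t" if "0 \<le> t" "t \<le> 1" for t
        using bspec[OF A(1), of t] that by (simp add: K_def algebra_simps)
    qed (use q in auto)
    with A(2) show False by (simp add: algebra_simps)
  qed
  have "Z \<inter> {0..q} \<noteq> {}"
  proof
    assume empty: "Z \<inter> {0..q} = {}"
    have "0 < K t" if "0 \<le> t" "t \<le> q" for t
      using K_nonneg[of t] empty that q by (force simp: Z_def)
    then show False
      using no_minorant affine_minorant_positive_left[OF K_cont K_nonneg q] by simp
  qed
  moreover have "compact (Z \<inter> {0..q})"
    using \<open>closed Z\<close> by (intro closed_Int_compact) auto
  \<comment> \<open>\<open>y\<close> is the last zero of \<open>K\<close> before \<open>q\<close>;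
    the first one after \<open>q\<close> will be \<open>z\<close>.\<close>
  ultimately obtain y where y: "y \<in> Z" "y \<in> {0..q}" "\<And>t. t \<in> Z \<inter> {0..q} \<Longrightarrow> t \<le> y"
    using compact_attains_sup by (metis IntD1 IntD2)
  have "Z \<inter> {q..1} \<noteq> {}"
  proof
    assume empty: "Z \<inter> {q..1} = {}"
    have "0 < K t" if "q \<le> t" "t \<le> 1" for t
    proof -
      have "t \<notin> Z" using empty that by auto
      then show ?thesis using K_nonneg[of t] that q by (auto simp: Z_def)
    qed
    then show False
      using no_minorant affine_minorant_positive_right[OF K_cont K_nonneg q] by simp
  qed
  moreover have "compact (Z \<inter> {q..1})"
    using \<open>closed Z\<close> by (intro closed_Int_compact) auto
  ultimately obtain z where z: "z \<in> Z" "z \<in> {q..1}" "\<And>t. t \<in> Z \<inter> {q..1} \<Longrightarrow> z \<le> t"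
    using compact_attains_inf by (metis IntD1 IntD2)
  have "q \<notin> Z" using K_q by (simp add: Z_def)
  then have yz: "0 \<le> y" "y < q" "q < z" "z \<le> 1"
    using y z by (auto simp: less_le)
  have Hy: "H y = G q + c * (y - q)" and Hz: "H z = G q + c * (z - q)"
    using y z by (auto simp: Z_def K_def)
  then have Gy: "G y = H y" and Gz: "G z = H z"
    using c[of y] c[of z] G_le_H[of y] G_le_H[of z] yz q by auto
  \<comment> \<open>At \<open>y\<close> and \<open>z\<close> the graph of \<open>G\<close> meets the
    supporting line, so convexity keeps \<open>G\<close> on or below that line in between, where
    \<open>K > 0\<close> puts \<open>H\<close> strictly above it.\<close>
  have "{y<..<z} \<subseteq> iron_T f a b"
  proof
    fix t assume t: "t \<in> {y<..<z}"
    have "t \<notin> Z"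
      using y(3)[of t] z(3)[of t] t yz by (cases "t \<le> q") (auto simp: Z_def)
    then have "0 < K t" using K_nonneg[of t] t yz by (auto simp: Z_def)
    have "G t \<le> (G z - G y) / (z - y) * (t - y) + G y"
      using t yz by (intro convex_onD_Icc' convex_on_subset[OF convex_on_G]) auto
    also have "(G z - G y) / (z - y) = c"
      using yz by (simp add: Gy Gz Hy Hz field_simps)
    finally have "G t < H t"
      using \<open>0 < K t\<close> by (simp add: Gy Hy K_def algebra_simps)
    then show "t \<in> iron_T f a b" using t yz by (auto simp: iron_T_def)
  qed
  moreover have "y \<notin> iron_T f a b" "z \<notin> iron_T f a b"
    using Gy Gz by (auto simp: iron_T_def)
  \<comment> \<open>Maximality: a connected \<open>d\<close> containing \<open>q\<close> and a point
    outside \<open>{y<..<z}\<close> would contain \<open>y\<close> or \<open>z\<close>, where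
    \<open>H = G\<close>.\<close>
  then have "d = {y<..<z}" if "{y<..<z} \<subseteq> d" "d \<subseteq> iron_T f a b" "connected d" for d
  proof -
    have "q \<in> d" using that yz by auto
    have "t \<in> {y<..<z}" if "t \<in> d" for t
    proof (rule ccontr)
      assume "t \<notin> {y<..<z}"
      then have "y \<in> {min t q..max t q} \<or> z \<in> {min t q..max t q}" using yz by auto
      moreover have "{min t q..max t q} \<subseteq> d"
        using connected_contains_Icc[OF \<open>connected d\<close>] \<open>t \<in> d\<close> \<open>q \<in> d\<close> by (auto simp: min_def max_def)
      ultimately show False
        using \<open>d \<subseteq> _\<close> \<open>y \<notin> _\<close> \<open>z \<notin> _\<close> by blast
    qed
    with that show ?thesis by blast
  qed
  ultimately have "{y<..<z} \<in> components (iron_T f a b)"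
    unfolding in_components_maximal using yz by (auto simp del: greaterThanLessThan_iff)
  moreover have "(z - y) * G q = (z - q) * H y + (q - y) * H z"
    by (simp add: Hy Hz algebra_simps)
  ultimately show thesis using that yz by blast
qed

section \<open>The derivative of \<open>G\<close> and monotonicity of its extension
  \<open>iron_g\<close>\<close>

definition diff_points :: "real set" where
  "diff_points = {t\<in>{0<..<1}. G differentiable (at t)}"

lemma iron_g_eq:
  "iron_g f a b q = (if q \<in> diff_points then deriv G q
     else if q < 1 then Lim (at q within (diff_points \<inter> {q<..})) (deriv G)
     else Lim (at q within (diff_points \<inter> {..<q})) (deriv G))"
  unfolding iron_g_def Let_def diff_points_def by (rule refl)

text \<open>The points of \<open>(0,1)\<close> that are missing form a countable set, which cannot
  cover an open interval.\<close>

lemma diff_points_dense: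
  assumes "0 \<le> x" "x < y" "y \<le> 1"
  obtains t where "t \<in> diff_points" "x < t" "t < y"
proof -
  have "countable {t \<in> {0<..<1}. \<not> G differentiable (at t)}"
    by (intro convex_on_countable_nondifferentiable convex_on_subset[OF convex_on_G]) auto
  then have "\<not> {x<..<y} \<subseteq> {t \<in> {0<..<1}. \<not> G differentiable (at t)}"
    using uncountable_open_interval[of x y] assms(2) countable_subset by blast
  with assms that show thesis by (force simp: diff_points_def)
qed

lemma deriv_G_mono:
  assumes s: "s \<in> diff_points" and t: "t \<in> diff_points" and "s \<le> t"
  shows "deriv G s \<le> deriv G t"
proof (cases "s = t")
  case False
  have tangent: "deriv G x * (y - x) \<le> G y - G x" if "x \<in> diff_points" "y \<in> diff_points" for x y
  proof (rule convex_on_imp_above_tangent[OF convex_on_G])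
    have "(G has_real_derivative deriv G x) (at x)"
      using that(1) by (simp add: diff_points_def DERIV_deriv_iff_real_differentiable)
    then show "(G has_real_derivative deriv G x) (at x within {0..1})"
      by (rule has_field_derivative_at_within)
  qed (use that in \<open>auto simp: diff_points_def\<close>)
  have "deriv G s * (t - s) \<le> deriv G t * (t - s)"
    using tangent[OF s t] tangent[OF t s] by (simp add: algebra_simps)
  with False \<open>s \<le> t\<close> show ?thesis by (auto simp: mult_le_cancel_right)
qed simp

text \<open>Off \<open>diff_points\<close>, \<open>iron_g\<close> is a right limit of the monotone
  \<open>deriv G\<close>, namely its infimum over later points, so it still fits between the
  derivatives on either side of \<open>q\<close>.\<close>

lemma iron_g_between:
  assumes q: "0 < q" "q < 1" and t: "t \<in> diff_points"
  shows "t < q \<Longrightarrow> deriv G t \<le> iron_g f a b q" and "q < t \<Longrightarrow> iron_g f a b q \<le> deriv G t"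
proof -
  have "(t < q \<longrightarrow> deriv G t \<le> iron_g f a b q) \<and> (q < t \<longrightarrow> iron_g f a b q \<le> deriv G t)"
  proof (cases "q \<in> diff_points")
    case True
    then have "iron_g f a b q = deriv G q" by (simp add: iron_g_eq)
    with True t deriv_G_mono show ?thesis by auto
  next
    case False
    define A where "A = deriv G ` (diff_points \<inter> {q<..})"
    obtain u where u: "u \<in> diff_points" "q < u" using diff_points_dense[of q 1] q by auto
    have lower: "deriv G t \<le> x" if "t \<in> diff_points" "t < q" "x \<in> A" for t x
      using that deriv_G_mono by (auto simp: A_def)
    obtain s where "s \<in> diff_points" "s < q" using diff_points_dense[of 0 q] q by auto
    then have bdd: "bdd_below A" using lower by (intro bdd_belowI[of _ "deriv G s"])
    have "A \<noteq> {}" using u by (auto simp: A_def)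
    have "(deriv G \<longlongrightarrow> Inf A) (at q within (diff_points \<inter> {q<..}))"
    proof (rule order_tendstoI)
      fix x assume "x < Inf A"
      then show "\<forall>\<^sub>F t in at q within (diff_points \<inter> {q<..}). x < deriv G t"
        unfolding eventually_at_filter
        by (intro always_eventually) (auto simp: A_def intro: less_le_trans[OF _ cInf_lower[OF _ bdd]])
    next
      fix x assume "Inf A < x"
      then obtain v where v: "v \<in> diff_points" "q < v" "deriv G v < x"
        using cInf_lessD[OF \<open>A \<noteq> {}\<close>] by (auto simp: A_def)
      have "\<forall>\<^sub>F t in nhds q. t \<in> {..<v}"
        using v by (intro eventually_nhds_in_open) auto
      then show "\<forall>\<^sub>F t in at q within (diff_points \<inter> {q<..}). deriv G t < x"
        unfolding eventually_at_filter
      proof eventually_elim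
        case (elim t)
        have "deriv G t < x" if "t \<in> diff_points" using le_less_trans[OF deriv_G_mono[OF that v(1)] v(3)] elim by simp
        then show ?case by simp
      qed
    qed
    \<comment> \<open>\<open>Lim\<close> determines the limit only along a nontrivial filter, so
      \<open>diff_points\<close> must accumulate at \<open>q\<close> from the right.\<close>
    moreover have "q islimpt (diff_points \<inter> {q<..})"
      unfolding islimpt_approachable
    proof (intro allI impI)
      fix e :: real assume "0 < e"
      then obtain v where "v \<in> diff_points" "q < v" "v < min 1 (q + e)"
        using diff_points_dense[of q "min 1 (q + e)"] q by auto
      then show "\<exists>x\<in>diff_points \<inter> {q<..}. x \<noteq> q \<and> dist x q < e"
        by (intro bexI[of _ v]) (auto simp: dist_real_def)
    qed
    ultimately have "Lim (at q within (diff_points \<inter> {q<..})) (deriv G) = Inf A"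
      by (intro tendsto_Lim) (simp_all add: trivial_limit_within)
    with False q have "iron_g f a b q = Inf A" by (simp add: iron_g_eq)
    moreover have "deriv G t \<le> Inf A" if "t < q"
      using lower[OF t that] \<open>A \<noteq> {}\<close> by (intro cInf_greatest)
    moreover have "Inf A \<le> deriv G t" if "q < t"
      using t that by (intro cInf_lower bdd) (simp add: A_def)
    ultimately show ?thesis by simp
  qed
  then show "t < q \<Longrightarrow> deriv G t \<le> iron_g f a b q" "q < t \<Longrightarrow> iron_g f a b q \<le> deriv G t" by auto
qed

text \<open>Any two distinct arguments are separated by a point of \<open>diff_points\<close>. The
  interval is open because \<open>iron_g\<close> at \<open>1\<close> may be an unspecified
  real.\<close>

lemma mono_on_iron_g: "mono_on {0<..<1} (iron_g f a b)"
proof (rule mono_onI)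
  fix p q :: real assume pq: "p \<in> {0<..<1}" "q \<in> {0<..<1}" "p \<le> q"
  show "iron_g f a b p \<le> iron_g f a b q"
  proof (cases "p = q")
    case False
    then obtain t where "t \<in> diff_points" "p < t" "t < q" using diff_points_dense[of p q] pq by auto
    then show ?thesis using iron_g_between[of p t] iron_g_between[of q t] pq by fastforce
  qed simp
qed

end

subsection \<open>Random tie-breaking and expected payments\<close>

text \<open>\<open>cheapest_sets\<close> with arbitrary scores \<open>u\<close>, so that
  tie-breaking becomes a purely combinatorial matter.\<close>

definition least_sets :: "'i set \<Rightarrow> nat \<Rightarrow> ('i \<Rightarrow> real) \<Rightarrow> 'i set set" where
  "least_sets N w u = {W. W \<subseteq> N \<and> card W = w \<and> (\<forall>i\<in>W. \<forall>j\<in>N - W. u i \<le> u j)}"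

text \<open>The chance that \<open>i\<close> belongs to a uniformly drawn least set.\<close>

definition share :: "'i set \<Rightarrow> nat \<Rightarrow> ('i \<Rightarrow> real) \<Rightarrow> 'i \<Rightarrow> real" where
  "share N w u i = real (card {W \<in> least_sets N w u. i \<in> W}) / real (card (least_sets N w u))"

lemma finite_least_sets: "finite N \<Longrightarrow> finite (least_sets N w u)"
  by (rule finite_subset[of _ "Pow N"]) (auto simp: least_sets_def)

text \<open>Greedy construction: a cheapest remaining element is added at each step.\<close>

lemma least_sets_nonempty:
  assumes "finite N" "w \<le> card N"
  shows "least_sets N w u \<noteq> {}"
  using assms(2)
proof (induction w)
  case 0
  have "{} \<in> least_sets N 0 u" by (simp add: least_sets_def)
  then show ?case by blast
next
  case (Suc w)
  then obtain W where W: "W \<subseteq> N" "card W = w" "\<forall>i\<in>W. \<forall>j\<in>N - W. u i \<le> u j"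
    by (auto simp: least_sets_def)
  have "finite W" using W assms(1) finite_subset by blast
  have "N - W \<noteq> {}" using W Suc.prems by (metis Diff_eq_empty_iff Suc_n_not_le_n subset_antisym)
  then obtain m where m: "m \<in> N - W" "\<forall>j\<in>N - W. u m \<le> u j"
    using assms(1) arg_min_if_finite[of "N - W" u] by (metis finite_Diff not_less)
  have "insert m W \<in> least_sets N (Suc w) u"
    using W m \<open>finite W\<close> by (auto simp: least_sets_def)
  then show ?case by blast
qed

lemma share_nonneg: "0 \<le> share N w u i"
  by (simp add: share_def)

lemma share_le_1: "finite N \<Longrightarrow> share N w u i \<le> 1"
  using card_mono[OF finite_least_sets, of N "{W \<in> least_sets N w u. i \<in> W}" w u]
  by (simp add: share_def divide_le_eq_1 card_gt_0_iff finite_least_sets)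

text \<open>Double counting of the pairs of a least set and one of its \<open>w\<close>
  members.\<close>

lemma sum_share:
  assumes "finite N" "w \<le> card N"
  shows "(\<Sum>i\<in>N. share N w u i) = real w"
proof -
  let ?C = "least_sets N w u"
  have fin: "finite ?C" and ne: "?C \<noteq> {}"
    using assms finite_least_sets least_sets_nonempty by blast+
  have "(\<Sum>i\<in>N. real (card {W \<in> ?C. i \<in> W})) = (\<Sum>i\<in>N. \<Sum>W\<in>?C. of_bool (i \<in> W))"
  proof (rule sum.cong)
    fix i
    have "{W \<in> ?C. i \<in> W} = ?C \<inter> {W. i \<in> W}" by blast
    then show "real (card {W \<in> ?C. i \<in> W}) = (\<Sum>W\<in>?C. of_bool (i \<in> W))"
      using fin by simp
  qed simp
  also have "\<dots> = (\<Sum>W\<in>?C. \<Sum>i\<in>N. of_bool (i \<in> W))"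
    by (rule sum.swap)
  also have "\<dots> = (\<Sum>W\<in>?C. real w)"
  proof (rule sum.cong)
    fix W assume "W \<in> ?C"
    then have "N \<inter> {i. i \<in> W} = W" "card W = w" by (auto simp: least_sets_def)
    then show "(\<Sum>i\<in>N. of_bool (i \<in> W)) = real w"
      using assms(1) by simp
  qed simp
  finally have "(\<Sum>i\<in>N. real (card {W \<in> ?C. i \<in> W})) = real (card ?C) * real w"
    by simp
  moreover have "real (card ?C) \<noteq> 0" using fin ne by simp
  ultimately show ?thesis
    by (simp add: share_def flip: sum_divide_distrib)
qed

text \<open>A player who loses in some least set at cost \<open>u i\<close> is preceded by \<open>w\<close> others of cost at
  most \<open>u i\<close>, and so cannot win at all at any larger cost.\<close>

lemma share_antimono:
  assumes "finite N" "w \<le> card N" and i: "i \<in> N" and eq: "\<And>j. j \<noteq> i \<Longrightarrow> u' j = u j" and le: "u i \<le> u' i"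
  shows "share N w u' i \<le> share N w u i"
proof (cases "u i = u' i")
  case True
  then have "u = u'" using eq by (metis ext)
  then show ?thesis by simp
next
  case False
  with le have less: "u i < u' i" by simp
  show ?thesis
  proof (cases "\<exists>W\<in>least_sets N w u. i \<notin> W")
    case True
    then obtain W where W: "W \<in> least_sets N w u" "i \<notin> W" by blast
    have "i \<notin> W'" if W': "W' \<in> least_sets N w u'" for W'
    proof
      assume "i \<in> W'"
      have "W \<subseteq> W' - {i}"
      proof
        fix j assume j: "j \<in> W"
        then have "u j \<le> u i" "j \<noteq> i" "j \<in> N" using W i by (auto simp: least_sets_def)
        then have "u' j < u' i" using less eq by simp
        then show "j \<in> W' - {i}"
          using W' \<open>i \<in> W'\<close> \<open>j \<noteq> i\<close> \<open>j \<in> N\<close> by (force simp: least_sets_def)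
      qed
      moreover have "finite W'" "card W' = w" "card W = w"
        using W W' finite_subset[OF _ \<open>finite N\<close>] by (auto simp: least_sets_def)
      ultimately show False
        using \<open>i \<in> W'\<close> by (metis card_Diff1_less card_mono finite_Diff not_less)
    qed
    then have "{W \<in> least_sets N w u'. i \<in> W} = {}" by blast
    then have "share N w u' i = 0" by (simp only: share_def) simp
    then show ?thesis by (simp add: share_nonneg)
  next
    case False
    then have "{W \<in> least_sets N w u. i \<in> W} = least_sets N w u" by blast
    then have "share N w u i = 1"
      using finite_least_sets[OF assms(1)] least_sets_nonempty[OF assms(1,2)] by (simp add: share_def)
    then show ?thesis using share_le_1[OF assms(1)] by simp
  qed
qed

text \<open>The share depends on \<open>u\<close> only through finitely many comparisons. Counting
  by a sum over the fixed set \<open>Pow N\<close> makes this visible.\<close>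

lemma borel_measurable_share:
  assumes "finite N" and i: "i \<in> N" and u: "\<And>j. j \<in> N \<Longrightarrow> (\<lambda>x. u x j) \<in> borel_measurable \<Omega>"
  shows "(\<lambda>x. share N w (u x) i) \<in> borel_measurable \<Omega>"
proof -
  have pred: "Measurable.pred \<Omega> (\<lambda>x. W \<in> least_sets N w (u x))" for W
  proof (cases "W \<subseteq> N")
    case True
    then have "finite W" using assms(1) finite_subset by blast
    have "Measurable.pred \<Omega> (\<lambda>x. u x j \<le> u x k)" if "j \<in> W" "k \<in> N - W" for j k
    proof -
      have [measurable]: "(\<lambda>x. u x j) \<in> borel_measurable \<Omega>" "(\<lambda>x. u x k) \<in> borel_measurable \<Omega>"
        using u that True by auto
      show ?thesis by measurable
    qed
    then have "Measurable.pred \<Omega> (\<lambda>x. \<forall>j\<in>W. \<forall>k\<in>N - W. u x j \<le> u x k)"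
      using \<open>finite W\<close> \<open>finite N\<close> by (intro pred_intros_finite) auto
    then show ?thesis unfolding least_sets_def mem_Collect_eq by (intro pred_intros_logic) auto
  qed (simp add: least_sets_def)
  have count: "real (card {W \<in> least_sets N w (u x). P W}) =
      (\<Sum>W\<in>Pow N. of_bool (W \<in> least_sets N w (u x) \<and> P W))" for P x
  proof -
    have "Pow N \<inter> {W. W \<in> least_sets N w (u x) \<and> P W} = {W \<in> least_sets N w (u x). P W}"
      by (auto simp: least_sets_def)
    then show ?thesis using \<open>finite N\<close> by simp
  qed
  have meas: "(\<lambda>x. real (card {W \<in> least_sets N w (u x). P W})) \<in> borel_measurable \<Omega>" for P
    unfolding count using pred[measurable] by measurable
  show ?thesis
    unfolding share_def using meas[of "\<lambda>W. i \<in> W"] meas[of "\<lambda>W. True"]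
    by (intro borel_measurable_divide) auto
qed

section \<open>Expected payment of one player facing a monotone allocation\<close>

context cost_distribution
begin

abbreviation "ivc \<equiv> ironed_virtual_cost f a b"

lemma borel_measurable_F [measurable]: "F \<in> borel_measurable borel"
  by (intro borel_measurable_mono monoI cdf_nondecreasing)

lemma borel_measurable_ivc [measurable]: "ivc \<in> borel_measurable borel"
proof -
  have "iron_g f a b \<in> borel_measurable (restrict_space borel {0<..<1})"
    by (rule borel_measurable_mono_on_fnc[OF mono_on_iron_g])
  then have [measurable]: "(\<lambda>q. indicator {0<..<1} q *\<^sub>R iron_g f a b q) \<in> borel_measurable borel"
    by (subst (asm) borel_measurable_restrict_space_iff) auto
  \<comment> \<open>Monotonicity is known on the open interval only; the levels
    \<open>F z = 0\<close> and \<open>F z = 1\<close> contribute constants.\<close>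
  have "ivc z = (if 0 < F z \<and> F z < 1 then indicator {0<..<1} (F z) *\<^sub>R iron_g f a b (F z)
      else if F z = 0 then iron_g f a b 0 else iron_g f a b 1)" for z
    using cdf_nonneg[of z] cdf_bounded_prob[of z] by (auto simp: ironed_virtual_cost_def)
  then show ?thesis by (subst measurable_cong) (assumption, measurable)
qed

lemma ivc_mono:
  assumes "a < s" "s \<le> t" "t < b"
  shows "ivc s \<le> ivc t"
  unfolding ironed_virtual_cost_def
  using F_strict_mono[of a s] F_strict_mono[of t b] cdf_nondecreasing[of s t] assms
  by (intro mono_onD[OF mono_on_iron_g]) (auto simp: F_a F_b)

text \<open>The primitive \<open>(s - k) * F s\<close> vanishes at \<open>a\<close>. The value is
  the expected payment \<open>t * F t\<close> for an offered price \<open>t\<close>, less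
  \<open>k\<close> per expected unit bought.\<close>

lemma has_integral_threshold:
  assumes "a \<le> t" "t \<le> b"
  shows "((\<lambda>s. (s - k) * f s + F s) has_integral (t - k) * F t) {a..t}"
proof -
  obtain P where P: "finite P" "\<And>z. z \<in> {a<..<b} - P \<Longrightarrow> (F has_real_derivative f z) (at z)"
    using F_deriv by blast
  have "((\<lambda>s. (s - k) * f s + F s) has_integral ((t - k) * F t - (a - k) * F a)) {a..t}"
  proof (rule fundamental_theorem_of_calculus_interior_strong[OF P(1) assms(1)])
    fix z assume "z \<in> {a<..<t} - P"
    then have "(F has_real_derivative f z) (at z)" using P assms by auto
    then have "((\<lambda>s. (s - k) * F s) has_real_derivative (z - k) * f z + F z) (at z)"
      by (auto intro!: derivative_eq_intros)
    then show "((\<lambda>s. (s - k) * F s) has_vector_derivative (z - k) * f z + F z) (at z)"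
      by (simp add: has_real_derivative_iff_has_vector_derivative)
  next
    show "continuous_on {a..t} (\<lambda>s. (s - k) * F s)"
      by (intro continuous_intros continuous_at_imp_continuous_on ballI isCont_F)
  qed
  then show ?thesis by (simp add: F_a)
qed

text \<open>By Fubini, a level \<open>t\<close> is counted by exactly the costs
  \<open>y \<le> t\<close>, which have mass \<open>F t\<close>.\<close>

lemma expected_remaining_area:
  assumes X [measurable]: "X \<in> borel_measurable borel" and X01: "\<And>t. 0 \<le> X t" "\<And>t. X t \<le> 1"
    and X0: "\<And>t. b < t \<Longrightarrow> X t = 0"
  shows "(\<integral>y. (LBINT t:{y..}. X t) \<partial>M) = (LBINT t:{a..b}. F t * X t)"
proof -
  interpret MI: pair_sigma_finite M lborel ..
  \<comment> \<open>The factor \<open>indicator {a..b} t\<close> gives a domain of finite measure.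
    It changes nothing, since \<open>X\<close> vanishes above \<open>b\<close> and almost every
    \<open>y\<close> exceeds \<open>a\<close>.\<close>
  let ?h = "\<lambda>y t. indicator {a..b} t * indicator {y..} t * X t :: real"
  have meas: "(\<lambda>(y, t). ?h y t) \<in> borel_measurable (M \<Otimes>\<^sub>M lborel)"
  proof -
    have eq: "?h y t = indicator {a..b} t * (if y \<le> t then 1 else 0) * X t" for y t
      by (simp add: indicator_def)
    show ?thesis unfolding eq by measurable
  qed
  have int: "integrable (M \<Otimes>\<^sub>M lborel) (\<lambda>(y, t). ?h y t)"
  proof (rule integrableI_bounded_set[where B = 1 and A = "space M \<times> {a..b}"])
    show "emeasure (M \<Otimes>\<^sub>M lborel) (space M \<times> {a..b}) < \<infinity>"
      using ab by (subst lborel.emeasure_pair_measure_Times) (auto simp: ennreal_mult_less_top less_top emeasure_eq_measure)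
  qed (use X01 meas in \<open>auto simp: indicator_def abs_le_iff order_trans[OF _ X01(1), of "-1"]\<close>)
  have "(\<integral>y. (LBINT t:{y..}. X t) \<partial>M) = (\<integral>y. (\<integral>t. ?h y t \<partial>lborel) \<partial>M)"
  proof (rule integral_cong_AE)
    show "AE y in M. (LBINT t:{y..}. X t) = (\<integral>t. ?h y t \<partial>lborel)"
      using AE_range unfolding set_lebesgue_integral_def
      by eventually_elim (use X0 in \<open>auto intro!: Bochner_Integration.integral_cong simp: indicator_def\<close>)
    show "(\<lambda>y. \<integral>t. ?h y t \<partial>lborel) \<in> borel_measurable M"
      using meas by (rule lborel.borel_measurable_lebesgue_integral)
    have eq: "(LBINT t:{y..}. X t) = (\<integral>t. (if y \<le> t then 1 else 0) * X t \<partial>lborel)" for y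
      unfolding set_lebesgue_integral_def by (intro Bochner_Integration.integral_cong) (auto simp: indicator_def)
    show "(\<lambda>y. (LBINT t:{y..}. X t)) \<in> borel_measurable M"
      unfolding eq by measurable
  qed
  also have "\<dots> = (\<integral>t. (\<integral>y. ?h y t \<partial>M) \<partial>lborel)"
    using MI.Fubini_integral[OF int] by simp
  also have "\<dots> = (LBINT t:{a..b}. F t * X t)"
    unfolding set_lebesgue_integral_def
  proof (rule Bochner_Integration.integral_cong)
    fix t
    have "(\<integral>y. ?h y t \<partial>M) = (\<integral>y. (indicator {a..b} t * X t) * indicator {..t} y \<partial>M)"
      by (intro Bochner_Integration.integral_cong) (auto simp: indicator_def)
    also have "\<dots> = indicator {a..b} t *\<^sub>R (F t * X t)"
      by (simp add: cdf_def)
    finally show "(\<integral>y. ?h y t \<partial>M) = indicator {a..b} t *\<^sub>R (F t * X t)" .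
  qed simp
  finally show ?thesis .
qed

text \<open>The second mean value theorem replaces the monotone \<open>X\<close> by the indicator of a single
  threshold \<open>t\<close>, for which the left-hand side is \<open>(t - k) * F t\<close>.\<close>

lemma expected_payment_ge:
  assumes X [measurable]: "X \<in> borel_measurable borel" and X01: "\<And>t. 0 \<le> X t" "\<And>t. X t \<le> 1"
    and X0: "\<And>t. b < t \<Longrightarrow> X t = 0"
    and X_mono: "\<And>s t. a < s \<Longrightarrow> s \<le> t \<Longrightarrow> t < b \<Longrightarrow> X t \<le> X s"
    and K: "\<And>t. a \<le> t \<Longrightarrow> t \<le> b \<Longrightarrow> K \<le> (t - k) * F t"
  shows "integrable M (\<lambda>y. (y - k) * X y + (LBINT t:{y..}. X t))"
    and "K \<le> (\<integral>y. (y - k) * X y + (LBINT t:{y..}. X t) \<partial>M)"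
proof -
  let ?h = "\<lambda>s. (s - k) * f s + F s"
  have Xabs: "\<bar>X t\<bar> \<le> 1" for t using X01[of t] by simp
  have bd: "AE y in M. norm ((y - k) * X y) \<le> \<bar>a\<bar> + \<bar>b\<bar> + \<bar>k\<bar>"
    using AE_range
  proof eventually_elim
    case (elim y)
    have "\<bar>y - k\<bar> * \<bar>X y\<bar> \<le> \<bar>y - k\<bar> * 1" by (intro mult_left_mono Xabs) simp
    moreover have "\<bar>y - k\<bar> \<le> \<bar>a\<bar> + \<bar>b\<bar> + \<bar>k\<bar>" using elim by linarith
    ultimately show ?case by (simp add: abs_mult)
  qed
  have int1: "integrable M (\<lambda>y. (y - k) * X y)"
    by (rule integrable_const_bound[OF bd]) measurable
  have area_int: "set_integrable lborel {a..b} X"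
    unfolding set_integrable_def
    by (rule integrableI_bounded_set_indicator[where B = 1]) (use Xabs ab in auto)
  have int2: "integrable M (\<lambda>y. LBINT t:{y..}. X t)"
  proof (rule integrable_const_bound[where B = "LBINT t:{a..b}. X t"])
    have eq: "(LBINT t:{y..}. X t) = (\<integral>t. (if y \<le> t then 1 else 0) * X t \<partial>lborel)" for y
      unfolding set_lebesgue_integral_def by (intro Bochner_Integration.integral_cong) (auto simp: indicator_def)
    show "(\<lambda>y. (LBINT t:{y..}. X t)) \<in> borel_measurable M"
      unfolding eq by measurable
    show "AE y in M. norm (LBINT t:{y..}. X t) \<le> (LBINT t:{a..b}. X t)"
      using AE_range
    proof eventually_elim
      case (elim y)
      have "0 \<le> (LBINT t:{y..}. X t)"
        using X01 by (simp add: set_lebesgue_integral_def Bochner_Integration.integral_nonneg)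
      moreover have "(LBINT t:{y..}. X t) \<le> (LBINT t:{a..b}. X t)"
        using area_int X01 X0 elim unfolding set_lebesgue_integral_def set_integrable_def
        by (intro integral_mono') (auto simp: indicator_def)
      ultimately show ?case by simp
    qed
  qed
  show "integrable M (\<lambda>y. (y - k) * X y + (LBINT t:{y..}. X t))"
    by (rule Bochner_Integration.integrable_add[OF int1 int2])
  have f1: "set_integrable lborel {a..b} (\<lambda>s. ((s - k) * f s) * X s)"
    unfolding set_integrable_def
  proof (rule Bochner_Integration.integrable_bound)
    show "integrable lborel (\<lambda>s. (\<bar>a\<bar> + \<bar>b\<bar> + \<bar>k\<bar>) * f s)" using f_integrable by simp
    show "AE s in lborel. norm (indicat_real {a..b} s *\<^sub>R (((s - k) * f s) * X s))
        \<le> norm ((\<bar>a\<bar> + \<bar>b\<bar> + \<bar>k\<bar>) * f s)"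
    proof (rule AE_I2)
      fix s
      have "\<bar>s - k\<bar> * f s * \<bar>X s\<bar> \<le> (\<bar>a\<bar> + \<bar>b\<bar> + \<bar>k\<bar>) * f s * 1" if "s \<in> {a..b}"
        using that f_nonneg[of s] Xabs[of s] by (intro mult_mono) auto
      then show "norm (indicat_real {a..b} s *\<^sub>R (((s - k) * f s) * X s))
        \<le> norm ((\<bar>a\<bar> + \<bar>b\<bar> + \<bar>k\<bar>) * f s)"
        using f_nonneg[of s] by (auto simp: indicator_def abs_mult)
    qed
  qed measurable
  have f2: "set_integrable lborel {a..b} (\<lambda>s. F s * X s)"
    unfolding set_integrable_def
    by (rule integrableI_bounded_set_indicator[where B = 1])
      (use ab Xabs cdf_nonneg cdf_bounded_prob in \<open>auto simp: abs_mult intro!: mult_le_one\<close>)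
  have "(\<integral>y. (y - k) * X y + (LBINT t:{y..}. X t) \<partial>M)
      = (\<integral>y. (y - k) * X y \<partial>M) + (\<integral>y. (LBINT t:{y..}. X t) \<partial>M)"
    by (rule Bochner_Integration.integral_add[OF int1 int2])
  also have "(\<integral>y. (y - k) * X y \<partial>M) = (LBINT s:{a..b}. ((s - k) * f s) * X s)"
    unfolding set_lebesgue_integral_def
  proof (subst integral_M)
    show "(LBINT y. f y * ((y - k) * X y)) = (LBINT s. indicator {a..b} s *\<^sub>R ((s - k) * f s * X s))"
    proof (rule Bochner_Integration.integral_cong)
      show "f s * ((s - k) * X s) = indicator {a..b} s *\<^sub>R ((s - k) * f s * X s)" for s
        using f_outside[of s] by (cases "s \<in> {a..b}") auto
    qed simp
  qed measurable
  also have "(\<integral>y. (LBINT t:{y..}. X t) \<partial>M) = (LBINT s:{a..b}. F s * X s)"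
    by (rule expected_remaining_area[OF X X01 X0])
  also have "(LBINT s:{a..b}. ((s - k) * f s) * X s) + (LBINT s:{a..b}. F s * X s)
      = (LBINT s:{a..b}. ((s - k) * f s) * X s + F s * X s)"
    using set_integral_add(2)[OF f1 f2] by simp
  also have "\<dots> = integral {a..b} (\<lambda>s. ((s - k) * f s) * X s + F s * X s)"
    by (rule set_borel_integral_eq_integral(2)[OF set_integral_add(1)[OF f1 f2]])
  also have "\<dots> = integral {a..b} (\<lambda>s. X s * ?h s)"
    by (simp add: algebra_simps)
  finally have *: "(\<integral>y. (y - k) * X y + (LBINT t:{y..}. X t) \<partial>M) = integral {a..b} (\<lambda>s. X s * ?h s)" .
  \<comment> \<open>\<open>g\<close> is \<open>- X\<close> with its values at the endpoints reset to
    \<open>- 1\<close> and \<open>0\<close>. It stays increasing because \<open>X\<close> lies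
    between \<open>0\<close> and \<open>1\<close>, and these values leave only
    \<open>integral {a..t}\<close> in the mean value formula.\<close>
  define g where "g s = (if s \<le> a then - 1 else if b \<le> s then 0 else - X s)" for s
  have h_int: "?h integrable_on {a..b}"
    using has_integral_threshold[of b k] ab by (auto simp: has_integral_integrable)
  have g_mono: "g x \<le> g y" if "x \<le> y" for x y
    using that X01 X_mono[of x y] ab by (auto simp: g_def)
  obtain t where t: "t \<in> {a..b}"
    "integral {a..b} (\<lambda>s. g s * ?h s) = g a * integral {a..t} ?h + g b * integral {t..b} ?h"
    by (rule second_mean_value_theorem[OF h_int less_imp_le[OF ab] g_mono])
  have "integral {a..b} (\<lambda>s. X s * ?h s) = integral {a..b} (\<lambda>s. - (g s * ?h s))"
    by (rule integral_spike[of "{a, b}"]) (auto simp: g_def)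
  also have "\<dots> = integral {a..t} ?h"
    using t ab by (simp add: g_def)
  also have "\<dots> = (t - k) * F t"
    using has_integral_threshold[of t k] t by (simp add: integral_unique)
  finally show "K \<le> (\<integral>y. (y - k) * X y + (LBINT t:{y..}. X t) \<partial>M)"
    using * K t by simp
qed

section \<open>The benchmark mechanism: measurability, integrability and the lower bound on
  \<open>OPT\<close>\<close>

lemma cheapest_sets_eq: "cheapest_sets f a b n w v = least_sets {..<n} w (\<lambda>j. ivc (v j))"
  by (simp add: cheapest_sets_def least_sets_def)

lemma allocation_eq:
  assumes "w \<le> n"
  shows "allocation f a b n w i v = (if b < v i then 0 else share {..<n} w (\<lambda>j. ivc (v j)) i)"
proof -
  let ?C = "least_sets {..<n} w (\<lambda>j. ivc (v j))"
  have "measure_pmf.prob (pmf_of_set ?C) {W. i \<in> W} = real (card (?C \<inter> {W. i \<in> W})) / real (card ?C)"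
    using assms by (intro measure_pmf_of_set least_sets_nonempty finite_least_sets) auto
  also have "?C \<inter> {W. i \<in> W} = {W \<in> ?C. i \<in> W}" by blast
  finally show ?thesis
    by (simp add: allocation_def winners_def cheapest_sets_eq share_def)
qed

lemma sets_cost_profiles [measurable_cong]: "sets (cost_profiles f n) = sets (\<Pi>\<^sub>M i\<in>{..<n}. borel)"
  unfolding cost_profiles_def by (intro sets_PiM_cong) auto

lemma prob_space_cost_profiles: "prob_space (cost_profiles f n)"
  unfolding cost_profiles_def by (rule prob_space_PiM) (rule prob_space_axioms)

lemma AE_cost_profiles: "i < n \<Longrightarrow> AE v in cost_profiles f n. a < v i \<and> v i < b"
  unfolding cost_profiles_def using AE_range by (intro AE_PiM_component) (auto intro: prob_space_axioms)

lemma borel_measurable_allocation: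
  assumes "w \<le> n" "i < n"
  shows "allocation f a b n w i \<in> borel_measurable (\<Pi>\<^sub>M i\<in>{..<n}. borel)"
proof -
  have [measurable]: "(\<lambda>v. v j) \<in> borel_measurable (\<Pi>\<^sub>M i\<in>{..<n}. borel)" if "j < n" for j
    using that by (intro measurable_component_singleton) simp
  have "(\<lambda>v. share {..<n} w (\<lambda>j. ivc (v j)) i) \<in> borel_measurable (\<Pi>\<^sub>M i\<in>{..<n}. borel)"
    using assms by (intro borel_measurable_share) auto
  with assms show ?thesis
    unfolding allocation_eq[OF assms(1)] by measurable
qed

lemma allocation_01:
  assumes "w \<le> n"
  shows "0 \<le> allocation f a b n w i v" "allocation f a b n w i v \<le> 1"
  by (auto simp: allocation_eq[OF assms] share_nonneg share_le_1)

lemma borel_measurable_payment: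
  assumes "w \<le> n" "i < n"
  shows "payment f a b n w i \<in> borel_measurable (cost_profiles f n)"
proof -
  note borel_measurable_allocation[OF assms, measurable]
  have [measurable]: "(\<lambda>v. v i) \<in> borel_measurable (\<Pi>\<^sub>M i\<in>{..<n}. borel)"
    using assms by (intro measurable_component_singleton) simp
  have [measurable]: "(\<lambda>(v, t). v(i := t)) \<in> (\<Pi>\<^sub>M i\<in>{..<n}. borel) \<Otimes>\<^sub>M lborel \<rightarrow>\<^sub>M (\<Pi>\<^sub>M i\<in>{..<n}. borel)"
    unfolding split_beta' using assms
    by (intro measurable_fun_upd[where J = "{..<n}"]) auto
  \<comment> \<open>The integral over a set depending on \<open>v\<close> is rewritten with one
    integrand in \<open>(v, t)\<close>, to which measurability of parametric integrals
    applies.\<close>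
  have "payment f a b n w i v = v i * allocation f a b n w i v
      + (\<integral>t. (if v i \<le> t then 1 else 0) * allocation f a b n w i (case (v, t) of (v, t) \<Rightarrow> v(i := t)) \<partial>lborel)" for v
    unfolding payment_def set_lebesgue_integral_def
    by (intro arg_cong2[where f = "(+)"] Bochner_Integration.integral_cong) (auto simp: indicator_def)
  then have eq: "payment f a b n w i = (\<lambda>v. v i * allocation f a b n w i v
      + (\<integral>t. (if v i \<le> t then 1 else 0) * allocation f a b n w i (case (v, t) of (v, t) \<Rightarrow> v(i := t)) \<partial>lborel))"
    by blast
  show ?thesis
    unfolding measurable_cong_sets[OF sets_cost_profiles refl] unfolding eq by measurable
qed

lemma integrable_allocation:
  assumes "w \<le> n" "i < n"
  shows "integrable (cost_profiles f n) (allocation f a b n w i)"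
proof -
  interpret P: prob_space "cost_profiles f n"
    by (rule prob_space_cost_profiles)
  show ?thesis
    using allocation_01[OF assms(1)] borel_measurable_allocation[OF assms]
    by (intro P.integrable_const_bound[where B = 1])
      (auto simp: measurable_cong_sets[OF sets_cost_profiles refl])
qed

text \<open>Almost surely the first summand is at most \<open>b\<close>, and the area at most
  \<open>b - a\<close>, because the allocation is at most \<open>1\<close> and vanishes above
  \<open>b\<close>.\<close>

lemma integrable_payment:
  assumes "w \<le> n" "i < n"
  shows "integrable (cost_profiles f n) (payment f a b n w i)"
proof -
  interpret P: prob_space "cost_profiles f n"
    by (rule prob_space_cost_profiles)
  show ?thesis
  proof (rule P.integrable_const_bound[where B = "b + (b - a)"])
    show "AE v in cost_profiles f n. norm (payment f a b n w i v) \<le> b + (b - a)"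
      using AE_cost_profiles[OF assms(2)]
    proof eventually_elim
      case (elim v)
      let ?X = "\<lambda>t. allocation f a b n w i (v(i := t))"
      have X: "0 \<le> ?X t" "?X t \<le> 1" for t
        using allocation_01[OF assms(1)] by auto
      have "v i * allocation f a b n w i v \<le> b * 1"
        using elim a_nonneg allocation_01[OF assms(1), of i v] by (intro mult_mono) auto
      moreover have "0 \<le> v i * allocation f a b n w i v"
        using elim a_nonneg allocation_01[OF assms(1), of i v] by auto
      moreover have "0 \<le> (LBINT t:{v i..}. ?X t)"
        unfolding set_lebesgue_integral_def using X by (intro Bochner_Integration.integral_nonneg) auto
      moreover have "(LBINT t:{v i..}. ?X t) \<le> (\<integral>t. indicator {a..b} t \<partial>lborel)"
        unfolding set_lebesgue_integral_def
      proof (rule integral_mono')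
        show "indicator {v i..} t *\<^sub>R ?X t \<le> indicator {a..b} t" for t
          using X[of t] elim by (auto simp: indicator_def allocation_eq[OF assms(1)])
      qed (use ab in auto)
      moreover have "(\<integral>t. indicator {a..b} t \<partial>lborel) = b - a"
        using ab by simp
      ultimately show ?case unfolding payment_def by (simp add: abs_le_iff)
    qed
  qed (rule borel_measurable_payment[OF assms])
qed

text \<open>With the costs of the others fixed, the allocation is a decreasing function of the own
  cost on \<open>(a,b)\<close>, so \<open>expected_payment_ge\<close> applies; integrating over the
  others gives the claim.\<close>

lemma expected_payment_of_player_ge:
  assumes wn: "w \<le> n" and i: "i < n" and K: "\<And>t. a \<le> t \<Longrightarrow> t \<le> b \<Longrightarrow> K \<le> (t - k) * F t"
  shows "K + k * (\<integral>v. allocation f a b n w i v \<partial>cost_profiles f n)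
    \<le> (\<integral>v. payment f a b n w i v \<partial>cost_profiles f n)"
proof -
  interpret P: prob_space "cost_profiles f n"
    by (rule prob_space_cost_profiles)
  interpret PS: product_sigma_finite "\<lambda>_::nat. M"
    by unfold_locales
  let ?A = "allocation f a b n w i" and ?N = "{..<n} - {i}"
  \<comment> \<open>Collecting all terms in one function leaves a single use of Fubini and a
    nonnegative inner integral.\<close>
  let ?h = "\<lambda>v. payment f a b n w i v - k * ?A v - K"
  have N: "insert i ?N = {..<n}" using i by auto
  have int: "integrable (\<Pi>\<^sub>M j\<in>insert i ?N. M) ?h"
    unfolding N using integrable_payment[OF wn i] integrable_allocation[OF wn i]
    by (simp add: P.integrable_const flip: cost_profiles_def)
  have "(\<integral>v. ?h v \<partial>cost_profiles f n) = (\<integral>x. (\<integral>y. ?h (x(i := y)) \<partial>M) \<partial>(\<Pi>\<^sub>M j\<in>?N. M))"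
    using PS.product_integral_insert[OF _ _ int] unfolding N cost_profiles_def by simp
  also have "\<dots> \<ge> 0"
  proof (rule integral_nonneg_AE, rule AE_I2)
    fix x assume x: "x \<in> space (\<Pi>\<^sub>M j\<in>?N. M)"
    let ?X = "\<lambda>t. ?A (x(i := t))"
    have "(\<lambda>t. x(i := t)) \<in> M \<rightarrow>\<^sub>M (\<Pi>\<^sub>M j\<in>insert i ?N. M)"
      using measurable_component_update[OF x, of i] by simp
    then have "(\<lambda>t. x(i := t)) \<in> borel \<rightarrow>\<^sub>M cost_profiles f n"
      unfolding N cost_profiles_def measurable_cong_sets[OF sets_M refl] .
    moreover have "?A \<in> borel_measurable (cost_profiles f n)"
      using borel_measurable_allocation[OF wn i] by (simp add: measurable_cong_sets[OF sets_cost_profiles refl])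
    ultimately have X: "?X \<in> borel_measurable borel"
      by (rule measurable_compose)
    \<comment> \<open>A higher own cost weakly raises the own score and leaves all other scores
      alone.\<close>
    have X_mono: "?X t \<le> ?X s" if "a < s" "s \<le> t" "t < b" for s t
      using that i wn unfolding allocation_eq[OF wn]
      by (auto intro!: share_antimono ivc_mono)
    have h: "?h (x(i := y)) = ((y - k) * ?X y + (LBINT t:{y..}. ?X t)) - K" for y
      by (simp add: payment_def algebra_simps)
    have X0: "?X t = 0" if "b < t" for t
      using that by (simp add: allocation_eq[OF wn])
    show "0 \<le> (\<integral>y. ?h (x(i := y)) \<partial>M)"
      using expected_payment_ge[OF X allocation_01[OF wn] X0 X_mono K]
      unfolding h by (simp add: prob_space[unfolded space_eq_univ])
  qed
  finally have "0 \<le> (\<integral>v. ?h v \<partial>cost_profiles f n)" .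
  also have "\<dots> = (\<integral>v. payment f a b n w i v \<partial>cost_profiles f n)
      - k * (\<integral>v. ?A v \<partial>cost_profiles f n) - K"
    using integrable_payment[OF wn i] integrable_allocation[OF wn i] by (simp add: P.prob_space)
  finally show ?thesis by simp
qed

text \<open>The slope \<open>k\<close> of a supporting line at \<open>w / n\<close> acts as a
  Lagrange multiplier: it makes the bound per player affine in the purchase probability, so that
  only the total \<open>w\<close> of these probabilities matters.\<close>

lemma OPT_ge:
  assumes w: "1 \<le> w" "w < n"
  shows "real n * G (real w / real n) \<le> OPT f a b n w"
proof -
  interpret P: prob_space "cost_profiles f n"
    by (rule prob_space_cost_profiles)
  have wn: "w \<le> n" using w by simp
  define q where "q = real w / real n"
  have q: "0 < q" "q < 1" using w by (auto simp: q_def)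
  obtain k where k: "\<And>t. 0 \<le> t \<Longrightarrow> t \<le> 1 \<Longrightarrow> G q + k * (t - q) \<le> G t"
    using G_supporting_line[OF q] by blast
  have K: "G q - k * q \<le> (t - k) * F t" if "a \<le> t" "t \<le> b" for t
  proof -
    have "0 \<le> F t" "F t \<le> 1" by (rule cdf_nonneg, rule cdf_bounded_prob)
    then have "G q + k * (F t - q) \<le> F t * t"
      using k[of "F t"] G_le_H[of "F t"] that by (simp add: H_eq Q_F)
    then show ?thesis by (simp add: algebra_simps)
  qed
  have "(\<Sum>i<n. \<integral>v. allocation f a b n w i v \<partial>cost_profiles f n)
      = (\<integral>v. (\<Sum>i<n. allocation f a b n w i v) \<partial>cost_profiles f n)"
    using integrable_allocation[OF wn] by (intro Bochner_Integration.integral_sum[symmetric]) auto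
  also have "\<dots> = (\<integral>v. real w \<partial>cost_profiles f n)"
  proof (rule integral_cong_AE)
    \<comment> \<open>Almost surely no cost exceeds \<open>b\<close>, so the cut-off in
      \<open>allocation\<close> is inactive and the shares add up.\<close>
    have "AE v in cost_profiles f n. \<forall>i\<in>{..<n}. a < v i \<and> v i < b"
      by (intro AE_finite_allI AE_cost_profiles) auto
    then show "AE v in cost_profiles f n. (\<Sum>i<n. allocation f a b n w i v) = real w"
    proof eventually_elim
      case (elim v)
      then have "(\<Sum>i<n. allocation f a b n w i v) = (\<Sum>i<n. share {..<n} w (\<lambda>j. ivc (v j)) i)"
        by (intro sum.cong) (auto simp: allocation_eq[OF wn] not_less less_imp_le dest: bspec)
      also have "\<dots> = real w" using wn by (intro sum_share) auto
      finally show ?case .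
    qed
  qed (use integrable_allocation[OF wn] in auto)
  finally have sum: "(\<Sum>i<n. \<integral>v. allocation f a b n w i v \<partial>cost_profiles f n) = real w"
    by (simp add: P.prob_space)
  \<comment> \<open>Since \<open>n * q = w\<close>, the terms in \<open>k\<close> cancel in the
    sum.\<close>
  have "real n * G q = (\<Sum>i<n. (G q - k * q) + k * (\<integral>v. allocation f a b n w i v \<partial>cost_profiles f n))"
    unfolding sum.distrib sum_distrib_left[symmetric] sum using w by (simp add: q_def algebra_simps)
  also have "\<dots> \<le> (\<Sum>i<n. \<integral>v. payment f a b n w i v \<partial>cost_profiles f n)"
    using wn K by (intro sum_mono expected_payment_of_player_ge) auto
  also have "\<dots> = OPT f a b n w"
    unfolding OPT_def using integrable_payment[OF wn]
    by (intro Bochner_Integration.integral_sum[symmetric]) auto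
  finally show ?thesis by (simp add: q_def)
qed

section \<open>The posted price, and the loss from ironing\<close>

lemma posted_price_payment_eq:
  assumes "1 \<le> w" "w < n"
  shows "posted_price_payment f a b n w = real w * Q (real w / real n)"
proof -
  define p where "p = Q (real w / real n)"
  have F_p: "F p = real w / real n"
    using assms by (simp add: p_def F_Q)
  have price: "(\<lambda>y. if y \<le> p then p else 0) = (\<lambda>y. p * indicator {..p} y)"
    by (auto simp: indicator_def)
  have meas: "(\<lambda>y::real. if y \<le> p then p else 0) \<in> borel_measurable M"
    unfolding price by measurable
  have comp: "distr (cost_profiles f n) M (\<lambda>v. v i) = M" if "i < n" for i
    unfolding cost_profiles_def using that
    by (intro distr_PiM_component[where M = "\<lambda>_. M"] prob_space_axioms) auto
  have proj: "(\<lambda>v. v i) \<in> cost_profiles f n \<rightarrow>\<^sub>M M" if "i < n" for i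
    unfolding cost_profiles_def using that by (intro measurable_component_singleton) simp
  have int_M: "integrable M (\<lambda>y. if y \<le> p then p else 0)"
    unfolding price by (intro integrable_mult_right integrable_real_indicator) (auto simp: emeasure_eq_measure)
  have int: "integrable (cost_profiles f n) (\<lambda>v. if v i \<le> p then p else 0)" if "i < n" for i
    using integrable_distr[OF proj[OF that], of "\<lambda>y. if y \<le> p then p else 0"] comp[OF that] int_M by simp
  have "(\<integral>v. (if v i \<le> p then p else 0) \<partial>cost_profiles f n) = p * F p" if "i < n" for i
  proof -
    have "(\<integral>v. (if v i \<le> p then p else 0) \<partial>cost_profiles f n)
        = (\<integral>y. (if y \<le> p then p else 0) \<partial>distr (cost_profiles f n) M (\<lambda>v. v i))"
      by (rule integral_distr[OF proj[OF that] meas, symmetric])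
    also have "\<dots> = p * F p"
      unfolding comp[OF that] price by (simp add: cdf_def)
    finally show ?thesis .
  qed
  then have "posted_price_payment f a b n w = (\<Sum>i<n. p * F p)"
    unfolding posted_price_payment_def Let_def p_def[symmetric]
    using int by (subst Bochner_Integration.integral_sum) auto
  also have "\<dots> = real w * p" using assms by (simp add: F_p)
  finally show ?thesis by (simp add: p_def)
qed

text \<open>Inside a component, \<open>G q\<close> interpolates \<open>H y\<close> and
  \<open>H z\<close>. Monotonicity of \<open>Q\<close> bounds \<open>H q\<close> by
  \<open>q * Q z\<close>, and passing from \<open>Q z\<close> to \<open>Q y\<close> in the left
  endpoint's share costs at most the factor \<open>r\<close>.\<close>

lemma H_le_G:
  assumes q: "0 < q" "q < 1" and r: "1 < r"
    and ironed: "\<And>a' b'. a' < b' \<Longrightarrow> {a'..<b'} \<in> ironed_intervals f a b \<Longrightarrow> a' \<ge> b' / r"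
  shows "H q \<le> r * G q"
proof (cases "q \<in> iron_T f a b")
  case False
  then have "H q = G q" using q by (simp add: iron_T_def)
  moreover have "1 * G q \<le> r * G q" using G_nonneg[of q] q r by (intro mult_right_mono) auto
  ultimately show ?thesis by simp
next
  case True
  obtain y z where yz: "0 \<le> y" "y < q" "q < z" "z \<le> 1"
    and comp: "{y<..<z} \<in> components (iron_T f a b)"
    and G: "(z - y) * G q = (z - q) * H y + (q - y) * H z"
    by (rule ironed_component[OF q True])
  have "{Q y..<Q z} \<in> ironed_intervals f a b"
    unfolding ironed_intervals_def using comp yz by (intro CollectI exI[of _ y] exI[of _ z]) auto
  moreover have "Q y < Q z" using yz by (intro Q_strict_mono) auto
  ultimately have Qy: "Q z \<le> r * Q y"
    using ironed[of "Q y" "Q z"] r by (simp add: field_simps)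
  have Qz: "0 \<le> Q z" "Q q \<le> Q z"
    using Q_range[of z] a_nonneg Q_mono[of q z] yz q by auto
  have "(z - y) * H q \<le> (z - y) * (q * Q z)"
    using yz q Qz by (simp add: H_eq mult_left_mono)
  \<comment> \<open>This writes \<open>q\<close> as a convex combination:
    \<open>(z - y) * q = (z - q) * y + (q - y) * z\<close>.\<close>
  also have "\<dots> = (z - q) * (y * Q z) + (q - y) * (z * Q z)"
    by (simp add: algebra_simps)
  also have "\<dots> \<le> (z - q) * (y * (r * Q y)) + (q - y) * (z * (r * Q z))"
    using yz Qy Qz r mult_right_mono[of 1 r "Q z"] by (intro add_mono mult_left_mono) auto
  also have "\<dots> = r * ((z - q) * H y + (q - y) * H z)"
    using yz by (simp add: H_eq algebra_simps)
  also have "\<dots> = (z - y) * (r * G q)"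
    by (simp add: G[symmetric])
  finally show ?thesis using yz by simp
qed

end

theorem theorem4p8:
  fixes f :: "real \<Rightarrow> real" and a b r :: real and n w :: nat
  assumes "1 \<le> w" and "w < n"
    and "regular_density f a b"
    and "r > 1"
    and "\<And>a' b'. a' < b' \<Longrightarrow> {a'..<b'} \<in> ironed_intervals f a b \<Longrightarrow> a' \<ge> b' / r"
  shows "posted_price_payment f a b n w = real w * F_inv f a b (real w / real n)
       \<and> real w * F_inv f a b (real w / real n) \<le> 2 * r * OPT f a b n w"
proof -
  interpret cost_distribution f a b
    using assms(3) by unfold_locales
  define q where "q = real w / real n"
  have q: "0 < q" "q < 1" using assms(1,2) by (auto simp: q_def)
  have OPT: "real n * G q \<le> OPT f a b n w"
    using OPT_ge[OF assms(1,2)] by (simp add: q_def)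
  have "0 \<le> real n * G q" using G_nonneg[of q] q by simp
  then have "0 \<le> r * OPT f a b n w" using OPT assms(4) by simp
  have "real w * Q q = real n * H q"
    using q assms(2) by (simp add: H_eq q_def)
  also have "\<dots> \<le> real n * (r * G q)"
    using H_le_G[OF q assms(4,5)] by (intro mult_left_mono) auto
  also have "\<dots> = r * (real n * G q)" by simp
  also have "\<dots> \<le> r * OPT f a b n w"
    using OPT assms(4) by (intro mult_left_mono) auto
  \<comment> \<open>The chain so far gives the factor \<open>r\<close>; nonnegativity of
    \<open>r * OPT\<close> relaxes it to \<open>2 * r\<close>.\<close>
  also have "\<dots> \<le> 2 * r * OPT f a b n w"
    using \<open>0 \<le> r * OPT f a b n w\<close> by simp
  finally show ?thesis
    using posted_price_payment_eq[OF assms(1,2)] by (simp add: q_def)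
qed

end
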